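(* (1) Let $k,n$ be two positive integers satisfying $k<n$ and let $p_0,\ldots,p_k\in\mathbb{R}^{1,n}$ be $(k+1)$ points in general position. Then the Lorentzian distance-squared mapping $L_{(p_0,\ldots,p_k)}$ is $\mathcal{A}$-equivalent to the distance-squared mapping $D_{(p_0,\ldots,p_k)}$ if and only if the recognition subspace $V(p_0,\ldots,p_k)$ is time-like. (2) Let $n$ be a positive integer and let $p_0,\ldots,p_n\in\mathbb{R}^{1,n}$ be $(n+1)$ points in general position. Then $L_{(p_0,\ldots,p_n)}$ is $\mathcal{A}$-equivalent to $D_{(p_0,\ldots,p_n)}$ if and only if $V(p_0,\ldots,p_n)$ is time-like or space-like. (3) Let $k,n$ be two positive integers satisfying $n<k$ and let $p_0,\ldots,p_k\in\mathbb{R}^{1,n}$ be $(k+1)$ points such that the $(n+2)$ points $p_0,\ldots,p_{n+1}$ are in general position. Then $L_{(p_0,\ldots,p_k)}$ is always $\mathcal{A}$-equivalent to $D_{(p_0,\ldots,p_k)}$.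
   Context: For a positive integer $n$, $\mathbb{R}^{1,n}$ denotes the vector space $\mathbb{R}^{n+1}$ (coordinates $x=(x_0,x_1,\ldots,x_n)$) equipped with the Lorentzian inner product $\langle x,y\rangle=-x_0y_0+x_1y_1+\cdots+x_ny_n$. A nonzero vector $x\in\mathbb{R}^{1,n}$ is space-like, light-like or time-like if $\langle x,x\rangle>0$, $=0$, $<0$ respectively. A vector subspace $V\subset\mathbb{R}^{1,n}$ is time-like if it contains a time-like vector; space-like if every nonzero vector of $V$ is space-like; light-like otherwise. For $p\in\mathbb{R}^{1,n}$, $\ell_p^2(x)=\langle x-p,x-p\rangle$ and $d_p^2(x)=(x-p)\cdot(x-p)$, where $x\cdot y=\sum_{i=0}^n x_iy_i$ is the Euclidean inner product. For points $p_0,\ldots,p_k\in\mathbb{R}^{1,n}=\mathbb{R}^{n+1}$ ($k\ge1$), the Lorentzian distance-squared mapping is $L_{(p_0,\ldots,p_k)}(x)=(\ell_{p_0}^2(x),\ldots,\ell_{p_k}^2(x))$ and the distance-squared mapping is $D_{(p_0,\ldots,p_k)}(x)=(d_{p_0}^2(x),\ldots,d_{p_k}^2(x))$, both regarded as maps $\mathbb{R}^{n+1}\to\mathbb{R}^{k+1}$. The recognition subspace is $V(p_0,\ldots,p_k)=\sum_{i=1}^k\mathbb{R}\,(p_i-p_0)$. The points $p_0,\ldots,p_k$ are in general position if $\dim V(p_0,\ldots,p_k)=k$. Two mappings $f,g:\mathbb{R}^{n+1}\to\mathbb{R}^{k+1}$ are $\mathcal{A}$-equivalent if there exist $C^\infty$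 diffeomorphisms $h:\mathbb{R}^{n+1}\to\mathbb{R}^{n+1}$ and $H:\mathbb{R}^{k+1}\to\mathbb{R}^{k+1}$ such that $g=H\circ f\circ h$. *)

theory Defs
  imports "HOL-Analysis.Analysis"
begin

text \<open>
  The space with coordinates \<open>x\<^sub>0, \<dots>, x\<^sub>n\<close> is \<open>real ^ 'a\<close> for a finite well-ordered type
  \<open>'a\<close> with \<open>n + 1\<close> elements; the coordinate \<open>x\<^sub>j\<close> is the component \<open>x $ i\<close> with
  \<open>coord_no i = j\<close>. Points \<open>p\<^sub>0, \<dots>, p\<^sub>k\<close> are the values \<open>p 0, \<dots>, p k\<close> of a sequence,
  whose further values are irrelevant.
\<close>

definition coord_no :: "'a::{finite,wellorder} \<Rightarrow> nat" where
  "coord_no i = card {..<i}"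

lemma bij_betw_coord_no:
  "bij_betw coord_no (UNIV :: 'a::{finite,wellorder} set) {..<CARD('a)}"
proof -
  have "strict_mono (coord_no :: 'a \<Rightarrow> nat)"
    by (auto simp: strict_mono_def coord_no_def intro!: psubset_card_mono)
  then have inj: "inj (coord_no :: 'a \<Rightarrow> nat)"
    by (rule strict_mono_imp_inj_on)
  have "range (coord_no :: 'a \<Rightarrow> nat) \<subseteq> {..<CARD('a)}"
    by (auto simp: coord_no_def intro!: psubset_card_mono)
  with inj show ?thesis
    by (simp add: bij_betw_def card_image card_subset_eq)
qed

definition lorentz_inner :: "real ^ 'a::{finite,wellorder} \<Rightarrow> real ^ 'a::_ \<Rightarrow> real" where
  "lorentz_inner x y =
    (\<Sum>i\<in>UNIV. if coord_no i = 0 then - (x $ i * y $ i) else x $ i * y $ i)"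

definition space_like :: "real ^ 'a::{finite,wellorder} \<Rightarrow> bool" where
  "space_like x \<longleftrightarrow> x \<noteq> 0 \<and> lorentz_inner x x > 0"

definition time_like :: "real ^ 'a::{finite,wellorder} \<Rightarrow> bool" where
  "time_like x \<longleftrightarrow> x \<noteq> 0 \<and> lorentz_inner x x < 0"

definition time_like_subspace :: "(real ^ 'a::{finite,wellorder}) set \<Rightarrow> bool" where
  "time_like_subspace V \<longleftrightarrow> subspace V \<and> (\<exists>x\<in>V. time_like x)"

definition space_like_subspace :: "(real ^ 'a::{finite,wellorder}) set \<Rightarrow> bool" where
  "space_like_subspace V \<longleftrightarrow> subspace V \<and> (\<forall>x\<in>V. x \<noteq> 0 \<longrightarrow> space_like x)"

definition lorentz_dist_sq :: "real ^ 'a::{finite,wellorder} \<Rightarrow> real ^ 'a::_ \<Rightarrow> real" where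
  "lorentz_dist_sq p x = lorentz_inner (x - p) (x - p)"

definition dist_sq :: "real ^ 'a \<Rightarrow> real ^ 'a \<Rightarrow> real" where
  "dist_sq p x = (x - p) \<bullet> (x - p)"

text \<open>
  The number \<open>k + 1\<close> of points used by the two mappings below is determined by the target:
  it is the number of elements of \<open>'b\<close>.
\<close>

definition lorentz_dist_sq_map ::
    "(nat \<Rightarrow> real ^ 'a::{finite,wellorder}) \<Rightarrow> real ^ 'a::_ \<Rightarrow> real ^ 'b::{finite,wellorder}" where
  "lorentz_dist_sq_map p x = (\<chi> i. lorentz_dist_sq (p (coord_no i)) x)"

definition dist_sq_map ::
    "(nat \<Rightarrow> real ^ 'a) \<Rightarrow> real ^ 'a \<Rightarrow> real ^ 'b::{finite,wellorder}" where
  "dist_sq_map p x = (\<chi> i. dist_sq (p (coord_no i)) x)"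

definition recognition_subspace :: "nat \<Rightarrow> (nat \<Rightarrow> real ^ 'a) \<Rightarrow> (real ^ 'a) set" where
  "recognition_subspace k p = span ((\<lambda>i. p i - p 0) ` {1..k})"

definition general_position :: "nat \<Rightarrow> (nat \<Rightarrow> real ^ 'a) \<Rightarrow> bool" where
  "general_position k p \<longleftrightarrow> dim (recognition_subspace k p) = k"

text \<open>
  In finite dimension, a map is of class \<open>C\<^sup>m\<^sup>+\<^sup>1\<close> iff it is differentiable and all its
  directional derivatives are of class \<open>C\<^sup>m\<close>.
\<close>

primrec C_k :: "nat \<Rightarrow> ('a::euclidean_space \<Rightarrow> 'b::euclidean_space) \<Rightarrow> bool" where
  "C_k 0 f \<longleftrightarrow> continuous_on UNIV f"
| "C_k (Suc m) f \<longleftrightarrow>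
    (\<exists>f'. (\<forall>x. (f has_derivative f' x) (at x)) \<and> (\<forall>v. C_k m (\<lambda>x. f' x v)))"

definition smooth :: "('a::euclidean_space \<Rightarrow> 'b::euclidean_space) \<Rightarrow> bool" where
  "smooth f \<longleftrightarrow> (\<forall>m. C_k m f)"

definition diffeomorphism :: "('a::euclidean_space \<Rightarrow> 'b::euclidean_space) \<Rightarrow> bool" where
  "diffeomorphism f \<longleftrightarrow> bij f \<and> smooth f \<and> smooth (inv f)"

definition A_equivalent ::
    "('a::euclidean_space \<Rightarrow> 'b::euclidean_space) \<Rightarrow> ('a \<Rightarrow> 'b) \<Rightarrow> bool" where
  "A_equivalent f g \<longleftrightarrow>
    (\<exists>h H. diffeomorphism h \<and> diffeomorphism H \<and> g = H \<circ> f \<circ> h)"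

end

theory Submission
  imports Defs
begin

text \<open>
  Let \<open>V\<close> be the recognition subspace and \<open>e\<close> the unit vector of the time axis. The Lorentzian form
  is the rank-one perturbation \<open>Q x = x \<bullet> x - 2 (e \<bullet> x)\<^sup>2\<close> of the Euclidean one, and
  \<open>lorentz_inner x (J y) = x \<bullet> y\<close> for the reflection \<open>J\<close> along \<open>e\<close>. Split \<open>e = a + b\<close> with
  \<open>b \<in> V\<close> and \<open>a\<close> Euclidean-orthogonal to \<open>V\<close>. Everything is governed by the number \<open>a \<bullet> a\<close>: the
  subspace \<open>V\<close> is time-like, light-like or space-like according to whether \<open>2 (a \<bullet> a)\<close> is less than,
  equal to or greater than \<open>1\<close> (\<open>subspace_causal_character\<close>).

  To construct equivalences, note that the components of each mapping differ from the first one by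
  affine functions of \<open>x\<close>. Moving the source by \<open>x \<mapsto> p\<^sub>0 + J (B (x - p\<^sub>0))\<close> makes these differences agree for both
  mappings up to constants, as soon as \<open>B x - x\<close> is always orthogonal to \<open>V\<close>. The differences
  determine the orthogonal projection \<open>v\<close> of \<open>x - p\<^sub>0\<close> to \<open>V\<close>, so a quadratic shear of the target
  can absorb every quadratic function of \<open>v\<close>. Hence it suffices that the form \<open>Q (B x)\<close> is \<open>\<plusminus> x \<bullet> x\<close>
  up to a quadratic form in \<open>v\<close> (\<open>A_equivalent_of_forms_agreeing\<close>). Completing the square in the
  direction of \<open>a\<close> achieves this with sign \<open>+\<close> if \<open>2 (a \<bullet> a) < 1\<close>, whatever the number of points,
  and with sign \<open>-\<close> if \<open>2 (a \<bullet> a) > 1\<close> and \<open>a\<close> spans the orthogonal complement of \<open>V\<close>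
  (\<open>complete_square\<close>). With more than \<open>n + 1\<close> points in the required position, \<open>V\<close> is the whole
  space, which is time-like.

  In the remaining cases the Lorentzian complement of \<open>V\<close> contains a light-like
  vector (\<open>exists_null_normal_vector\<close>), so a fibre of the Lorentzian mapping contains a line, whereas
  the fibres of the distance-squared mapping are compact; an equivalence carries fibres
  homeomorphically to fibres (\<open>not_A_equivalent_of_null_vector\<close>).
\<close>

section \<open>Smooth maps\<close>

lemma C_k_const: "C_k m (\<lambda>x. c)"
  by (induction m arbitrary: c) (auto intro!: exI[of _ "\<lambda>x v. 0"])

lemma C_k_linear_image:
  assumes "linear L" and "C_k m f"
  shows "C_k m (\<lambda>x. L (f x))"
  using assms(2)
proof (induction m arbitrary: f)
  case 0
  then show ?case
    using linear_continuous_on_compose[of UNIV f L] assms(1) by simp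
next
  case (Suc m)
  then obtain f' where f': "\<And>x. (f has_derivative f' x) (at x)" "\<And>v. C_k m (\<lambda>x. f' x v)"
    by auto
  have "((\<lambda>x. L (f x)) has_derivative (\<lambda>v. L (f' x v))) (at x)" for x
    using bounded_linear.has_derivative[OF linear_conv_bounded_linear[THEN iffD1, OF assms(1)] f'(1)] .
  then show ?case
    using Suc.IH[OF f'(2)] by (auto intro!: exI[of _ "\<lambda>x v. L (f' x v)"])
qed

lemma C_k_ident: "C_k m (\<lambda>x. x)"
proof (cases m)
  case (Suc l)
  then show ?thesis by (auto intro!: exI[of _ "\<lambda>x v. v"] C_k_const)
qed auto

lemma C_k_add:
  assumes "C_k m f" and "C_k m g"
  shows "C_k m (\<lambda>x. f x + g x)"
  using assms
proof (induction m arbitrary: f g)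
  case 0
  then show ?case by (simp add: continuous_on_add)
next
  case (Suc m)
  obtain f' where f': "\<And>x. (f has_derivative f' x) (at x)" "\<And>v. C_k m (\<lambda>x. f' x v)"
    using Suc.prems(1) by auto
  obtain g' where g': "\<And>x. (g has_derivative g' x) (at x)" "\<And>v. C_k m (\<lambda>x. g' x v)"
    using Suc.prems(2) by auto
  show ?case
    using has_derivative_add[OF f'(1) g'(1)] Suc.IH[OF f'(2) g'(2)]
    by (auto intro!: exI[of _ "\<lambda>x v. f' x v + g' x v"])
qed

text \<open>
  The product rule involves the undifferentiated factors, so the induction for products uses that
  the classes decrease.
\<close>

lemma C_k_Suc_imp_C_k: "C_k (Suc m) f \<Longrightarrow> C_k m f"
proof (induction m arbitrary: f)
  case 0
  then show ?case
    by (auto intro!: continuous_at_imp_continuous_on dest: has_derivative_continuous)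
next
  case (Suc m)
  obtain f' where f': "\<And>x. (f has_derivative f' x) (at x)" "\<And>v. C_k (Suc m) (\<lambda>x. f' x v)"
    using Suc.prems unfolding C_k.simps(2)[of "Suc m" f] by blast
  show ?case
    using f'(1) Suc.IH[OF f'(2)] by auto
qed

lemma C_k_bilinear:
  assumes "bounded_bilinear pr" and "C_k m f" and "C_k m g"
  shows "C_k m (\<lambda>x. pr (f x) (g x))"
  using assms(2,3)
proof (induction m arbitrary: f g)
  case 0
  then show ?case
    using bounded_bilinear.continuous_on[OF assms(1), of UNIV f g] by simp
next
  case (Suc m)
  obtain f' where f': "\<And>x. (f has_derivative f' x) (at x)" "\<And>v. C_k m (\<lambda>x. f' x v)"
    using Suc.prems(1) by auto
  obtain g' where g': "\<And>x. (g has_derivative g' x) (at x)" "\<And>v. C_k m (\<lambda>x. g' x v)"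
    using Suc.prems(2) by auto
  have "C_k m (\<lambda>x. pr (f x) (g' x v) + pr (f' x v) (g x))" for v
    using Suc.IH[OF C_k_Suc_imp_C_k[OF Suc.prems(1)] g'(2)]
      Suc.IH[OF f'(2) C_k_Suc_imp_C_k[OF Suc.prems(2)]] by (rule C_k_add)
  then show ?case
    using bounded_bilinear.FDERIV[OF assms(1) f'(1) g'(1)]
    by (auto intro!: exI[of _ "\<lambda>x v. pr (f x) (g' x v) + pr (f' x v) (g x)"])
qed

lemma smooth_const: "smooth (\<lambda>x. c)"
  by (simp add: smooth_def C_k_const del: C_k.simps)

lemma smooth_ident: "smooth (\<lambda>x. x)"
  by (simp add: smooth_def C_k_ident)

lemma smooth_add: "smooth f \<Longrightarrow> smooth g \<Longrightarrow> smooth (\<lambda>x. f x + g x)"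
  by (simp add: smooth_def C_k_add)

lemma smooth_linear_image: "linear L \<Longrightarrow> smooth f \<Longrightarrow> smooth (\<lambda>x. L (f x))"
  by (simp add: smooth_def C_k_linear_image)

lemma smooth_diff: "smooth f \<Longrightarrow> smooth g \<Longrightarrow> smooth (\<lambda>x. f x - g x)"
  using smooth_add[of f "\<lambda>x. - g x"] smooth_linear_image[of uminus g]
  by (simp add: linear_uminus)

lemma smooth_inner: "smooth f \<Longrightarrow> smooth g \<Longrightarrow> smooth (\<lambda>x. f x \<bullet> g x)"
  by (simp add: smooth_def C_k_bilinear[OF bounded_bilinear_inner])

lemma smooth_imp_continuous_on: "smooth f \<Longrightarrow> continuous_on UNIV f"
  unfolding smooth_def by (metis C_k.simps(1))

lemma diffeomorphismI:
  assumes "smooth f" and "smooth g" and "\<And>x. g (f x) = x" and "\<And>y. f (g y) = y"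
  shows "diffeomorphism f"
proof -
  have "inv f = g"
    using assms(3,4) by (intro inv_equality) auto
  moreover have "bij f"
    using assms(3,4) by (intro o_bij[of g]) auto
  ultimately show ?thesis
    using assms(1,2) by (simp add: diffeomorphism_def)
qed

lemma diffeomorphism_affine:
  fixes L :: "'v::euclidean_space \<Rightarrow> 'v"
  assumes "linear L" and "inj L"
  shows "diffeomorphism (\<lambda>x. p + L (x - p))"
proof -
  obtain M where M: "linear M" "\<And>x. M (L x) = x" "\<And>x. L (M x) = x"
    using linear_injective_isomorphism[OF assms] by auto
  have *: "smooth (\<lambda>x. p + K (x - p))" if "linear K" for K :: "'v \<Rightarrow> 'v"
    by (intro smooth_add smooth_const smooth_linear_image[OF that] smooth_diff smooth_ident)
  show ?thesis
    by (rule diffeomorphismI[OF *[OF assms(1)] *[OF M(1)]]) (simp_all add: M)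
qed

section \<open>Shears of the target\<close>

text \<open>
  Both mappings, in suitable source coordinates, have the form \<open>t *\<^sub>R 1 + y\<close> up to a constant, where
  \<open>t\<close> is the component at the base index \<open>j\<close> and \<open>y\<close>, vanishing at \<open>j\<close>, collects the differences of
  the components. In the coordinates \<open>(t, y)\<close> this map is \<open>(t, y) \<mapsto> (\<epsilon> t + q y, y)\<close> with the
  quadratic form \<open>q y = P y \<bullet> R y\<close>; \<open>c\<close> and \<open>d\<close> are the constants at its source and target.
\<close>

definition quadratic_shear ::
    "'b \<Rightarrow> real \<Rightarrow> (real ^ 'b \<Rightarrow> 'v::euclidean_space) \<Rightarrow> (real ^ 'b \<Rightarrow> 'v) \<Rightarrow>
      real ^ 'b \<Rightarrow> real ^ 'b \<Rightarrow> real ^ 'b \<Rightarrow> real ^ 'b" where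
  "quadratic_shear j \<epsilon> P R c d z =
    (let y = z - (z $ j) *\<^sub>R 1 - c in (\<epsilon> * z $ j + P y \<bullet> R y) *\<^sub>R 1 + y + d)"

lemma smooth_quadratic_shear:
  fixes P R :: "real ^ 'b \<Rightarrow> 'v::euclidean_space"
  assumes "linear P" and "linear R"
  shows "smooth (quadratic_shear j \<epsilon> P R c d)"
proof -
  have lin: "linear (\<lambda>z::real^'b. (z $ j) *\<^sub>R 1 :: real^'b)" "linear (\<lambda>t::real. t *\<^sub>R 1 :: real^'b)"
      "linear (\<lambda>z::real^'b. \<epsilon> * z $ j)"
    by (auto intro!: linearI simp: algebra_simps)
  have y: "smooth (\<lambda>z. z - (z $ j) *\<^sub>R 1 - c)"
    by (intro smooth_diff smooth_ident smooth_const smooth_linear_image[OF lin(1)])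
  have "smooth (\<lambda>z. (\<epsilon> * z $ j + P (z - (z $ j) *\<^sub>R 1 - c) \<bullet> R (z - (z $ j) *\<^sub>R 1 - c)) *\<^sub>R 1
      + (z - (z $ j) *\<^sub>R 1 - c) + d)"
    by (intro smooth_add smooth_const y smooth_linear_image[OF lin(2)]
        smooth_linear_image[OF lin(3)] smooth_ident smooth_inner smooth_linear_image[OF assms(1) y]
        smooth_linear_image[OF assms(2) y])
  then show ?thesis
    by (simp add: quadratic_shear_def[abs_def] Let_def)
qed

text \<open>
  The differences \<open>y\<close> are preserved, so \<open>q y\<close> can be subtracted again: the inverse is a shear of the
  same kind.
\<close>

lemma quadratic_shear_inverse:
  assumes "\<epsilon> \<noteq> 0" and "c $ j = 0" and "d $ j = 0"
  shows "quadratic_shear j (1 / \<epsilon>) P (\<lambda>y. (- 1 / \<epsilon>) *\<^sub>R R y) d c (quadratic_shear j \<epsilon> P R c d z) = z"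
proof -
  define y where "y = z - (z $ j) *\<^sub>R 1 - c"
  define t where "t = \<epsilon> * z $ j + P y \<bullet> R y"
  have w: "quadratic_shear j \<epsilon> P R c d z = t *\<^sub>R 1 + y + d"
    by (simp add: quadratic_shear_def Let_def y_def t_def)
  have j: "(t *\<^sub>R 1 + y + d) $ j = t"
    using assms by (simp add: y_def)
  show ?thesis
    unfolding w quadratic_shear_def[of _ "1/\<epsilon>"] j Let_def
    using assms(1) by (simp add: t_def y_def algebra_simps add_divide_distrib)
qed

lemma diffeomorphism_quadratic_shear:
  assumes "\<epsilon> \<noteq> 0" and "linear P" and "linear R" and "c $ j = 0" and "d $ j = 0"
  shows "diffeomorphism (quadratic_shear j \<epsilon> P R c d)"
proof (rule diffeomorphismI)
  let ?G = "quadratic_shear j (1 / \<epsilon>) P (\<lambda>y. (- 1 / \<epsilon>) *\<^sub>R R y) d c"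
  have lin: "linear (\<lambda>y. (- 1 / \<epsilon>) *\<^sub>R R y)"
    using assms(3) by (rule linear_compose_scale_right)
  show "smooth (quadratic_shear j \<epsilon> P R c d)" "smooth ?G"
    using assms lin by (auto intro: smooth_quadratic_shear)
  show "?G (quadratic_shear j \<epsilon> P R c d z) = z" for z
    using assms by (rule_tac quadratic_shear_inverse)
  show "quadratic_shear j \<epsilon> P R c d (?G z) = z" for z
    using quadratic_shear_inverse[of "1 / \<epsilon>" d j c P "\<lambda>y. (- 1 / \<epsilon>) *\<^sub>R R y" z] assms by simp
qed

section \<open>The Lorentzian form as a perturbation of the Euclidean one\<close>

lemma coord_no_eq_0_unique:
  fixes i j :: "'a::{finite,wellorder}"
  assumes "coord_no i = 0" and "coord_no j = 0"
  shows "i = j"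
  using bij_betw_coord_no[where 'a='a] assms by (auto simp: bij_betw_def inj_on_def)

lemma coord_no_obtain:
  assumes "m < CARD('a::{finite,wellorder})"
  obtains i :: "'a::{finite,wellorder}" where "coord_no i = m"
  using bij_betw_coord_no[where 'a='a] assms
  by (metis bij_betw_iff_bijections lessThan_iff)

lemma coord_no_less: "coord_no (i :: 'a::{finite,wellorder}) < CARD('a)"
  using bij_betw_coord_no[where 'a='a] by (auto simp: bij_betw_def)

lemma lorentz_inner_eq:
  fixes x y :: "real ^ 'a::{finite,wellorder}"
  assumes "coord_no (j :: 'a) = 0"
  shows "lorentz_inner x y = x \<bullet> y - 2 * (axis j 1 \<bullet> x) * (axis j 1 \<bullet> y)"
proof -
  have "lorentz_inner x y = (\<Sum>i\<in>UNIV. x $ i * y $ i - (if i = j then 2 * x $ i * y $ i else 0))"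
    unfolding lorentz_inner_def
    by (rule sum.cong) (auto simp: assms dest: coord_no_eq_0_unique[OF assms])
  then show ?thesis
    by (simp add: sum_subtractf inner_vec_def[of x y] inner_axis')
qed

definition reflect :: "'v::real_inner \<Rightarrow> 'v \<Rightarrow> 'v" where
  "reflect e x = x - (2 * (e \<bullet> x)) *\<^sub>R e"

lemma linear_reflect: "linear (reflect e)"
  by (auto intro!: linearI simp: reflect_def algebra_simps)

lemma reflect_reflect: "e \<bullet> e = 1 \<Longrightarrow> reflect e (reflect e x) = x"
  by (simp add: reflect_def algebra_simps)

lemma lorentz_inner_reflect_left:
  fixes x y :: "real ^ 'a::{finite,wellorder}"
  assumes "coord_no (j :: 'a) = 0"
  shows "lorentz_inner (reflect (axis j 1) x) y = x \<bullet> y"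
    and "lorentz_inner x (reflect (axis j 1) y) = x \<bullet> y"
  by (simp_all add: lorentz_inner_eq[OF assms] reflect_def algebra_simps inner_commute)

lemma lorentz_inner_reflect_both:
  fixes x y :: "real ^ 'a::{finite,wellorder}"
  assumes "coord_no (j :: 'a) = 0"
  shows "lorentz_inner (reflect (axis j 1) x) (reflect (axis j 1) y) = lorentz_inner x y"
  using lorentz_inner_reflect_left(1)[OF assms]
  by (simp add: lorentz_inner_eq[OF assms] reflect_def algebra_simps inner_commute)

text \<open>
  The map \<open>B\<close> is sought in the form \<open>x + (\<sigma> (a \<bullet> x) + \<rho> (b \<bullet> x)) a\<close>. Along \<open>a\<close> the
  form is \<open>1 - 2 (a \<bullet> a)\<close> times the Euclidean one, and stretching by \<open>s = 1 + \<sigma> (a \<bullet> a)\<close> makes this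
  factor \<open>1\<close> or \<open>- 1\<close>; the choice of \<open>\<rho>\<close> removes the mixed term \<open>(a \<bullet> x) (b \<bullet> x)\<close>.
  When \<open>2 (a \<bullet> a) > 1\<close> the sign along \<open>a\<close> is reversed, which is the meaning of \<open>k = 2 / (a \<bullet> a)\<close>.
\<close>

lemma complete_square:
  fixes a b :: "'v::euclidean_space"
  assumes ab: "a \<bullet> b = 0" and e1: "a \<bullet> a + b \<bullet> b = 1" and ne: "2 * (a \<bullet> a) \<noteq> 1"
  defines "k \<equiv> (if 2 * (a \<bullet> a) < 1 then 0 else 2 / (a \<bullet> a))"
    and "\<rho> \<equiv> 2 / (1 - 2 * (a \<bullet> a))"
  obtains B where "linear B" and "inj B" and "\<And>x. \<exists>r. B x = x + r *\<^sub>R a"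
    and "\<And>x. B x \<bullet> B x - 2 * ((a + b) \<bullet> B x)\<^sup>2 = x \<bullet> x - k * (a \<bullet> x)\<^sup>2 - \<rho> * (b \<bullet> x)\<^sup>2"
proof -
  define \<alpha> where "\<alpha> = a \<bullet> a"
  define s where "s = 1 / sqrt \<bar>1 - 2 * \<alpha>\<bar>"
  define \<sigma> where "\<sigma> = (s - 1) / \<alpha>"
  define l where "l x = \<sigma> * (a \<bullet> x) + \<rho> * (b \<bullet> x)" for x
  define B where "B x = x + l x *\<^sub>R a" for x
  have ne': "1 - 2 * \<alpha> \<noteq> 0"
    using ne by (simp add: \<alpha>_def)
  have s: "s > 0" "s\<^sup>2 * \<bar>1 - 2 * \<alpha>\<bar> = 1"
    using ne' by (auto simp: s_def power_divide)
  have \<rho>: "\<rho> * (1 - 2 * \<alpha>) = 2"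
    using ne' unfolding \<rho>_def \<alpha>_def[symmetric] by (metis nonzero_eq_divide_eq)
  have lin: "linear B"
    by (auto intro!: linearI simp: B_def l_def algebra_simps)
  have aB: "a \<bullet> B x = a \<bullet> x + l x * \<alpha>" and bB: "b \<bullet> B x = b \<bullet> x" for x
    using ab by (simp_all add: B_def \<alpha>_def inner_add_right inner_commute)
  \<comment> \<open>Injectivity and the value of the form are both read off from this formula; division by zero
    in \<open>\<sigma>\<close> is harmless because it occurs only for \<open>a = 0\<close>.\<close>
  have aB': "a \<bullet> B x = s * (a \<bullet> x) + \<rho> * \<alpha> * (b \<bullet> x)" for x
  proof (cases "\<alpha> = 0")
    case True
    then have "a = 0" by (simp add: \<alpha>_def)
    then show ?thesis by (simp add: \<alpha>_def)
  next
    case False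
    then show ?thesis by (simp add: aB l_def \<sigma>_def field_simps)
  qed
  have "inj B"
  proof (rule linear_injective_0[OF lin, THEN iffD2], intro allI impI)
    fix x assume B0: "B x = 0"
    then have b0: "b \<bullet> x = 0"
      using bB[of x] by simp
    then have "a \<bullet> x = 0"
      using aB'[of x] B0 s(1) by simp
    then show "x = 0"
      using B0 b0 by (simp add: B_def l_def)
  qed
  moreover have "\<exists>r. B x = x + r *\<^sub>R a" for x
    by (auto simp: B_def)
  moreover have "B x \<bullet> B x - 2 * ((a + b) \<bullet> B x)\<^sup>2 = x \<bullet> x - k * (a \<bullet> x)\<^sup>2 - \<rho> * (b \<bullet> x)\<^sup>2" for x
  proof (cases "\<alpha> = 0")
    case True
    then have "a = 0" by (simp add: \<alpha>_def)
    then show ?thesis by (simp add: B_def \<rho>_def)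
  next
    case False
    then have pos: "\<alpha> > 0" by (simp add: \<alpha>_def)
    define \<tau> where "\<tau> = a \<bullet> x"
    define \<mu> where "\<mu> = b \<bullet> x"
    define \<theta> where "\<theta> = a \<bullet> B x"
    \<comment> \<open>Multiplied by \<open>\<alpha>\<close>, the form depends on \<open>l x\<close> only through \<open>\<theta>\<close>, where \<open>s\<close> and \<open>\<rho>\<close> enter linearly.\<close>
    have "B x \<bullet> B x = x \<bullet> x + 2 * l x * \<tau> + (l x)\<^sup>2 * \<alpha>"
      by (simp add: B_def \<tau>_def \<alpha>_def inner_add_left inner_add_right inner_commute power2_eq_square)
    then have "\<alpha> * (B x \<bullet> B x) = \<alpha> * (x \<bullet> x) + \<theta>\<^sup>2 - \<tau>\<^sup>2"
      by (simp add: \<theta>_def aB \<tau>_def algebra_simps power2_eq_square)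
    then have 1: "\<alpha> * (B x \<bullet> B x - 2 * ((a + b) \<bullet> B x)\<^sup>2) =
        \<alpha> * (x \<bullet> x) + \<theta>\<^sup>2 - \<tau>\<^sup>2 - 2 * \<alpha> * (\<theta> + \<mu>)\<^sup>2"
      by (simp add: right_diff_distrib inner_add_left \<theta>_def \<mu>_def bB)
    have \<theta>: "\<theta> = s * \<tau> + \<rho> * \<alpha> * \<mu>"
      by (simp add: \<theta>_def aB' \<tau>_def \<mu>_def)
    have "\<theta>\<^sup>2 - 2 * \<alpha> * (\<theta> + \<mu>)\<^sup>2 =
        (1 - 2 * \<alpha>) * \<theta>\<^sup>2 - 4 * \<alpha> * \<theta> * \<mu> - 2 * \<alpha> * \<mu>\<^sup>2"
      by (simp add: power2_eq_square algebra_simps)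
    also have "\<dots> = (1 - 2 * \<alpha>) * s\<^sup>2 * \<tau>\<^sup>2 + 2 * \<alpha> * s * \<tau> * \<mu> * (\<rho> * (1 - 2 * \<alpha>) - 2)
        + \<alpha> * \<mu>\<^sup>2 * (\<rho> * (\<rho> * (1 - 2 * \<alpha>)) * \<alpha> - 4 * \<rho> * \<alpha> - 2)"
      unfolding \<theta> by (simp add: power2_eq_square algebra_simps)
    also have "\<rho> * (\<rho> * (1 - 2 * \<alpha>)) * \<alpha> - 4 * \<rho> * \<alpha> - 2 = - \<rho>"
      unfolding \<rho> using \<rho> by (simp add: algebra_simps)
    also have "(1 - 2 * \<alpha>) * s\<^sup>2 = 1 - k * \<alpha>"
      using s(2) pos ne' by (auto simp: k_def \<alpha>_def[symmetric] abs_if algebra_simps split: if_splits)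
    finally have "\<theta>\<^sup>2 - 2 * \<alpha> * (\<theta> + \<mu>)\<^sup>2 = (1 - k * \<alpha>) * \<tau>\<^sup>2 - \<alpha> * \<rho> * \<mu>\<^sup>2"
      by (simp add: \<rho>)
    then have "\<alpha> * (B x \<bullet> B x - 2 * ((a + b) \<bullet> B x)\<^sup>2) =
        \<alpha> * (x \<bullet> x - k * \<tau>\<^sup>2 - \<rho> * \<mu>\<^sup>2)"
      unfolding 1 by (simp add: algebra_simps)
    then show ?thesis
      using pos by (simp add: \<tau>_def \<mu>_def)
  qed
  ultimately show ?thesis
    using that lin by blast
qed

section \<open>The causal character of the recognition subspace\<close>

text \<open>
  On \<open>V\<close> the Lorentzian form is \<open>v \<bullet> v - 2 (b \<bullet> v)\<^sup>2\<close>, which by the Cauchy-Schwarz inequality is at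
  least \<open>v \<bullet> v\<close> times \<open>1 - 2 (b \<bullet> b) = 2 (a \<bullet> a) - 1\<close>, with equality at \<open>v = b\<close>.
\<close>

lemma subspace_causal_character:
  fixes a b :: "real ^ 'a::{finite,wellorder}"
  assumes j: "coord_no (j :: 'a) = 0" and e: "axis j 1 = a + b"
    and V: "subspace V" "b \<in> V" and a: "\<And>v. v \<in> V \<Longrightarrow> a \<bullet> v = 0"
  shows "time_like_subspace V \<longleftrightarrow> 2 * (a \<bullet> a) < 1"
    and "space_like_subspace V \<longleftrightarrow> 2 * (a \<bullet> a) > 1"
proof -
  have "(axis j 1 :: real ^ 'a::_) \<bullet> axis j 1 = 1"
    by (simp add: inner_axis_axis)
  then have sum1: "a \<bullet> a + b \<bullet> b = 1"
    using a[OF V(2)] by (simp add: e inner_add_left inner_add_right inner_commute)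
  have Q: "lorentz_inner v v = v \<bullet> v - 2 * (b \<bullet> v)\<^sup>2" if "v \<in> V" for v
    using a[OF that] by (simp add: lorentz_inner_eq[OF j] e inner_add_left power2_eq_square)
  have Qb: "lorentz_inner b b = (b \<bullet> b) * (2 * (a \<bullet> a) - 1)"
  proof -
    have aa: "a \<bullet> a = 1 - b \<bullet> b"
      using sum1 by simp
    show ?thesis
      unfolding Q[OF V(2)] aa by (simp add: power2_eq_square algebra_simps)
  qed
  have lower: "lorentz_inner v v \<ge> (v \<bullet> v) * (2 * (a \<bullet> a) - 1)" if "v \<in> V" for v
  proof -
    have "(b \<bullet> v)\<^sup>2 \<le> (b \<bullet> b) * (v \<bullet> v)"
      by (rule Cauchy_Schwarz_ineq)
    also have "b \<bullet> b = 1 - a \<bullet> a"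
      using sum1 by simp
    finally show ?thesis
      by (simp add: Q[OF that] algebra_simps)
  qed
  show "time_like_subspace V \<longleftrightarrow> 2 * (a \<bullet> a) < 1"
  proof
    assume "time_like_subspace V"
    then obtain v where v: "v \<in> V" "v \<noteq> 0" "lorentz_inner v v < 0"
      by (auto simp: time_like_subspace_def time_like_def)
    then have "(v \<bullet> v) * (2 * (a \<bullet> a) - 1) < 0"
      using lower[OF v(1)] by simp
    then show "2 * (a \<bullet> a) < 1"
      using v(2) inner_ge_zero[of v] unfolding mult_less_0_iff by linarith
  next
    assume less: "2 * (a \<bullet> a) < 1"
    then have "b \<bullet> b > 0"
      using sum1 inner_ge_zero[of a] by linarith
    then have "time_like b"
      using less by (auto simp: time_like_def Qb mult_less_0_iff)
    then show "time_like_subspace V"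
      using V by (auto simp: time_like_subspace_def)
  qed
  show "space_like_subspace V \<longleftrightarrow> 2 * (a \<bullet> a) > 1"
  proof
    assume sp: "space_like_subspace V"
    show "2 * (a \<bullet> a) > 1"
    proof (cases "b = 0")
      case True
      then show ?thesis using sum1 by simp
    next
      case False
      then have "lorentz_inner b b > 0"
        using sp V(2) by (auto simp: space_like_subspace_def space_like_def)
      then show ?thesis
        using inner_ge_zero[of b] unfolding Qb zero_less_mult_iff by linarith
    qed
  next
    assume greater: "2 * (a \<bullet> a) > 1"
    have "space_like v" if "v \<in> V" "v \<noteq> 0" for v
    proof -
      have "(v \<bullet> v) * (2 * (a \<bullet> a) - 1) > 0"
        using that greater by simp
      then show ?thesis
        using that lower[OF that(1)] by (simp add: space_like_def)
    qed
    then show "space_like_subspace V"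
      using V by (auto simp: space_like_subspace_def)
  qed
qed

section \<open>Equivalence\<close>

text \<open>
  In the hypothesis on the forms, \<open>v\<close> is the orthogonal projection of \<open>x\<close> to the recognition subspace.
  Since \<open>v\<close> is a linear function of the differences of the components, the discrepancy between the
  two forms is a quadratic function of them, and a shear of the target removes it.
\<close>

lemma A_equivalent_of_forms_agreeing:
  fixes p :: "nat \<Rightarrow> real ^ 'a::{finite,wellorder}" and b :: "real ^ 'a::_"
  assumes card: "CARD('b::{finite,wellorder}) = k + 1"
    and B: "linear B" "inj B"
    and perp: "\<And>x v. v \<in> recognition_subspace k p \<Longrightarrow> v \<bullet> B x = v \<bullet> x"
    and eps: "\<epsilon> \<noteq> 0"
    and form: "\<And>x v. v \<in> recognition_subspace k p \<Longrightarrow>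
      (\<And>u. u \<in> recognition_subspace k p \<Longrightarrow> u \<bullet> (x - v) = 0) \<Longrightarrow>
      x \<bullet> x = \<epsilon> * lorentz_inner (B x) (B x) + \<kappa> * (v \<bullet> v) + \<rho> * (b \<bullet> v)\<^sup>2"
  shows "A_equivalent (lorentz_dist_sq_map p :: real ^ 'a::_ \<Rightarrow> real ^ 'b::_) (dist_sq_map p)"
proof -
  let ?V = "recognition_subspace k p"
  obtain j :: 'a where j: "coord_no j = 0"
    by (rule coord_no_obtain[of 0]) auto
  obtain o' :: 'b where o': "coord_no o' = 0"
    by (rule coord_no_obtain[of 0]) auto
  define J where "J = reflect (axis j 1 :: real ^ 'a::_)"
  define u where "u i = p (coord_no (i::'b)) - p 0" for i
  have uV: "u i \<in> ?V" for i
  proof (cases "coord_no i = 0")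
    case True
    then show ?thesis by (simp add: u_def recognition_subspace_def span_zero)
  next
    case False
    then have "coord_no i \<in> {1..k}"
      using coord_no_less[of i] card by auto
    then show ?thesis
      by (auto simp: u_def recognition_subspace_def intro: span_base)
  qed
  define S where "S x = (\<chi> i. - 2 * (u i \<bullet> x)) " for x
  have linS: "linear S"
    by (auto intro!: linearI simp: S_def vec_eq_iff algebra_simps)
  have kerS: "w \<bullet> x = 0" if S0: "S x = 0" and w: "w \<in> ?V" for x w
  proof -
    have "orthogonal x w"
    proof (rule orthogonal_to_span)
      show "w \<in> span ((\<lambda>i. p i - p 0) ` {1..k})"
        using w by (simp add: recognition_subspace_def)
      fix y assume "y \<in> (\<lambda>i. p i - p 0) ` {1..k}"
      then obtain m where m: "m \<in> {1..k}" "y = p m - p 0" by auto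
      then obtain i :: 'b where i: "coord_no i = m"
        using coord_no_obtain[of m] card by (metis atLeastAtMost_iff less_Suc_eq_le Suc_eq_plus1)
      have "u i \<bullet> x = 0"
        using S0 by (simp add: S_def vec_eq_iff)
      then show "orthogonal x y"
        by (simp add: m i u_def orthogonal_def inner_commute)
    qed
    then show ?thesis by (simp add: orthogonal_def inner_commute)
  qed
  have subV: "subspace ?V"
    by (simp add: recognition_subspace_def)
  have "inj_on S ?V"
  proof (rule linear_inj_on_iff_eq_0[OF linS subV, THEN iffD2], intro ballI impI)
    fix x assume "x \<in> ?V" "S x = 0"
    then show "x = 0" using kerS[of x x] by simp
  qed
  then obtain M where M: "range M \<subseteq> ?V" "linear M" "\<And>v. v \<in> ?V \<Longrightarrow> M (S v) = v"
    using linear_exists_left_inverse_on[OF linS subV] by auto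
  \<comment> \<open>\<open>M (S x)\<close> is the orthogonal projection of \<open>x\<close> to the recognition subspace.\<close>
  have SMS: "S (M (S x)) = S x" for x
  proof -
    obtain y z where yz: "y \<in> ?V" "\<And>w. w \<in> ?V \<Longrightarrow> orthogonal z w" "x = y + z"
      using orthogonal_subspace_decomp_exists[of "(\<lambda>i. p i - p 0) ` {1..k}" x]
      unfolding recognition_subspace_def by metis
    have "S z = 0"
      using yz(2)[OF uV] by (simp add: S_def vec_eq_iff orthogonal_def inner_commute)
    then have "S x = S y"
      by (simp add: yz(3) linear_add[OF linS])
    then show ?thesis
      by (simp add: M(3)[OF yz(1)])
  qed
  have MV: "M y \<in> ?V" for y
    using M(1) by auto
  have proj: "w \<bullet> (x - M (S x)) = 0" if "w \<in> ?V" for w x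
    using kerS[OF _ that, of "x - M (S x)"] by (simp add: linear_diff[OF linS] SMS)
  define c where "c = (\<chi> i. lorentz_inner (u i) (u i))"
  define d where "d = (\<chi> i. u i \<bullet> u i)"
  \<comment> \<open>chosen such that \<open>M y \<bullet> R y\<close> is the discrepancy of the forms at the projection \<open>M y\<close>\<close>
  define R where "R y = \<kappa> *\<^sub>R M y + (\<rho> * (b \<bullet> M y)) *\<^sub>R b" for y
  have linR: "linear R"
    using M(2) by (auto intro!: linearI simp: R_def linear_add linear_scale algebra_simps)
  have "u o' = 0"
    by (simp add: u_def o')
  then have o0: "c $ o' = 0" "d $ o' = 0" "S x $ o' = 0" for x
    by (simp_all add: c_def d_def S_def lorentz_inner_eq[OF j])
  define h where "h x = p 0 + J (B (x - p 0))" for x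
  define H where "H = quadratic_shear o' \<epsilon> M R c d"
  have "diffeomorphism h"
    unfolding h_def
  proof (rule diffeomorphism_affine)
    show "linear (\<lambda>x. J (B x))"
      using linear_compose[OF B(1) linear_reflect] by (simp add: J_def o_def)
    have "J (J x) = x" for x
      by (simp add: J_def reflect_reflect inner_axis_axis)
    then have "inj J" by (metis injI)
    then show "inj (\<lambda>x. J (B x))"
      using inj_compose[OF _ B(2)] by (simp add: comp_def)
  qed
  moreover have "diffeomorphism H"
    unfolding H_def using eps M(2) linR o0 by (intro diffeomorphism_quadratic_shear) auto
  moreover have "dist_sq_map p x = H (lorentz_dist_sq_map p (h x))" for x
  proof -
    define X where "X = x - p 0"
    define f where "f = lorentz_inner (B X) (B X)"
    have uJB: "lorentz_inner (u i) (J (B X)) = u i \<bullet> X" for i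
      using perp[OF uV] by (simp add: J_def lorentz_inner_reflect_left[OF j])
    have "lorentz_dist_sq (p (coord_no i)) (h x) = f + S X $ i + c $ i" for i
    proof -
      have eq: "h x - p (coord_no i) = J (B X) - u i"
        by (simp add: h_def u_def X_def)
      have "lorentz_dist_sq (p (coord_no i)) (h x)
          = lorentz_inner (J (B X)) (J (B X)) - 2 * lorentz_inner (u i) (J (B X)) + c $ i"
        unfolding lorentz_dist_sq_def eq
        by (simp add: c_def lorentz_inner_eq[OF j] algebra_simps inner_commute)
      then show ?thesis
        by (simp only: uJB) (simp add: S_def f_def J_def lorentz_inner_reflect_both[OF j])
    qed
    then have L: "lorentz_dist_sq_map p (h x) = f *\<^sub>R 1 + S X + c"
      by (simp add: lorentz_dist_sq_map_def vec_eq_iff)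
    have "dist_sq (p (coord_no i)) x = X \<bullet> X + S X $ i + d $ i" for i
    proof -
      have eq: "x - p (coord_no i) = X - u i"
        by (simp add: X_def u_def)
      show ?thesis
        unfolding dist_sq_def eq by (simp add: S_def d_def algebra_simps inner_commute)
    qed
    then have D: "dist_sq_map p x = (X \<bullet> X) *\<^sub>R 1 + S X + d"
      by (simp add: dist_sq_map_def vec_eq_iff)
    have "X \<bullet> X = \<epsilon> * f + M (S X) \<bullet> R (S X)"
      using form[OF MV[of "S X"], of X] proj
      by (simp add: f_def R_def inner_add_right power2_eq_square inner_commute)
    moreover have "H (f *\<^sub>R 1 + S X + c) = (\<epsilon> * f + M (S X) \<bullet> R (S X)) *\<^sub>R 1 + S X + d"
      by (simp add: H_def quadratic_shear_def Let_def o0)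
    ultimately show ?thesis
      by (simp add: L D)
  qed
  ultimately show ?thesis
    unfolding A_equivalent_def by (intro exI[of _ h] exI[of _ H]) (auto simp: fun_eq_iff)
qed

section \<open>Inequivalence\<close>

lemma bounded_dist_sq_fibre:
  "bounded (dist_sq_map p -` {c} :: (real ^ 'a::finite) set)" for c :: "real ^ 'b::{finite,wellorder}"
proof -
  fix i :: 'b
  have "dist (p (coord_no i)) x = sqrt (c $ i)" if "dist_sq_map p x = c" for x
    using that[symmetric] by (simp add: dist_sq_map_def dist_sq_def)
      (metis dist_commute dist_norm norm_eq_sqrt_inner)
  then have "dist_sq_map p -` {c} \<subseteq> cball (p (coord_no i)) (sqrt (c $ i))"
    by auto
  then show ?thesis
    using bounded_cball bounded_subset by blast
qed

text \<open>
  The line through \<open>p\<^sub>0\<close> in the direction of \<open>w\<close> lies in one fibre of the Lorentzian mapping, but that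
  fibre would be the image of a compact fibre of the distance-squared mapping.
\<close>

lemma not_A_equivalent_of_null_vector:
  fixes p :: "nat \<Rightarrow> real ^ 'a::{finite,wellorder}"
  assumes card: "CARD('b::{finite,wellorder}) = k + 1"
    and w: "w \<noteq> 0" "lorentz_inner w w = 0"
    and perp: "\<And>v. v \<in> recognition_subspace k p \<Longrightarrow> lorentz_inner v w = 0"
  shows "\<not> A_equivalent (lorentz_dist_sq_map p :: real ^ 'a::_ \<Rightarrow> real ^ 'b::_) (dist_sq_map p)"
proof
  let ?L = "lorentz_dist_sq_map p :: real ^ 'a::_ \<Rightarrow> real ^ 'b::_"
  let ?D = "dist_sq_map p :: real ^ 'a::_ \<Rightarrow> real ^ 'b::_"
  assume "A_equivalent ?L ?D"
  then obtain h H where hH: "diffeomorphism h" "diffeomorphism H" "\<And>x. ?D x = H (?L (h x))"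
    unfolding A_equivalent_def by (metis comp_apply)
  obtain j :: 'a where j: "coord_no j = 0"
    by (rule coord_no_obtain[of 0]) auto
  have line: "?L (p 0 + t *\<^sub>R w) = ?L (p 0)" for t
  proof -
    have "lorentz_dist_sq (p (coord_no i)) (p 0 + t *\<^sub>R w) = lorentz_dist_sq (p (coord_no i)) (p 0)"
      for i :: 'b
    proof -
      define u where "u = p (coord_no i) - p 0"
      have "u \<in> recognition_subspace k p"
      proof (cases "coord_no i = 0")
        case False
        then have "coord_no i \<in> {1..k}"
          using coord_no_less[of i] card by auto
        then show ?thesis
          by (auto simp: u_def recognition_subspace_def intro: span_base)
      qed (simp add: u_def recognition_subspace_def span_zero)
      then have uw: "lorentz_inner u w = 0"
        by (rule perp)
      have "lorentz_dist_sq (p (coord_no i)) (p 0 + t *\<^sub>R w)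
          = lorentz_inner u u - 2 * t * lorentz_inner u w + t\<^sup>2 * lorentz_inner w w"
        by (simp add: lorentz_dist_sq_def lorentz_inner_eq[OF j] u_def algebra_simps inner_commute
            power2_eq_square)
      then show ?thesis
        by (simp add: uw w(2)) (simp add: lorentz_dist_sq_def lorentz_inner_eq[OF j] u_def
            algebra_simps inner_commute)
    qed
    then show ?thesis by (simp add: lorentz_dist_sq_map_def)
  qed
  let ?F = "?D -` {H (?L (p 0))}"
  have "continuous_on UNIV ?D"
    unfolding dist_sq_map_def dist_sq_def by (intro continuous_intros)
  then have "closed ?F"
    by (simp add: continuous_closed_vimage continuous_on_eq_continuous_at)
  then have "compact ?F"
    using bounded_dist_sq_fibre by (simp add: compact_eq_bounded_closed)
  moreover have "continuous_on UNIV h"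
    using hH(1) by (simp add: diffeomorphism_def smooth_imp_continuous_on)
  ultimately have "compact (h ` ?F)"
    by (meson compact_continuous_image continuous_on_subset subset_UNIV)
  then obtain r where r: "\<And>y. y \<in> h ` ?F \<Longrightarrow> norm y \<le> r"
    using compact_imp_bounded bounded_iff by metis
  have "norm (p 0 + t *\<^sub>R w) \<le> r" for t
  proof (rule r)
    obtain x where x: "h x = p 0 + t *\<^sub>R w"
      using hH(1) by (metis diffeomorphism_def bij_pointE)
    then have "x \<in> ?F"
      using line[of t] by (simp add: hH(3))
    then show "p 0 + t *\<^sub>R w \<in> h ` ?F"
      using x by (metis imageI)
  qed
  note le = this
  have "\<bar>t\<bar> * norm w \<le> r + norm (p 0)" for t
    using le[of t] norm_triangle_ineq4[of "p 0 + t *\<^sub>R w" "p 0"] by simp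
  from this[of "(r + norm (p 0) + 1) / norm w"] w(1) show False
    by (auto simp: abs_le_iff dest: order_trans[OF mult_right_mono[OF abs_ge_self norm_ge_zero]])
qed

text \<open>
  The reflection along the time axis preserves the Lorentzian form and carries the Euclidean
  complement of \<open>V\<close> to the Lorentzian one, so it suffices to find a null vector \<open>t\<close> orthogonal to \<open>V\<close>.
  There the form is \<open>t \<bullet> t - 2 (a \<bullet> t)\<^sup>2\<close>. In the light-like case \<open>a\<close> itself is null; otherwise it is
  time-like, and adding to \<open>a\<close> a suitable multiple of a vector orthogonal to \<open>a\<close> and \<open>V\<close>, which is
  space-like, gives a null vector.
\<close>

lemma exists_null_normal_vector:
  fixes a b :: "real ^ 'a::{finite,wellorder}"
  assumes j: "coord_no (j :: 'a) = 0" and e: "axis j 1 = a + b"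
    and V: "b \<in> V" and a: "\<And>v. v \<in> V \<Longrightarrow> a \<bullet> v = 0"
    and ge: "2 * (a \<bullet> a) \<ge> 1"
    and cases: "2 * (a \<bullet> a) = 1 \<or> dim V + 2 \<le> CARD('a)"
  obtains w where "w \<noteq> 0" "lorentz_inner w w = 0" "\<And>v. v \<in> V \<Longrightarrow> lorentz_inner v w = 0"
proof -
  have "\<exists>t. (\<forall>v\<in>V. t \<bullet> v = 0) \<and> t \<noteq> 0 \<and> t \<bullet> t = 2 * (a \<bullet> t)\<^sup>2"
  proof (cases "2 * (a \<bullet> a) = 1")
    case True
    then have "a \<bullet> a = 2 * (a \<bullet> a)\<^sup>2"
      by (simp add: power2_eq_square)
    then show ?thesis
      using True a by (intro exI[of _ a]) auto
  next
    case False
    have "dim (insert a V) < DIM(real ^ 'a::_)"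
      using False cases by (simp add: dim_insert)
    then obtain z where z: "z \<noteq> 0" "\<And>y. y \<in> span (insert a V) \<Longrightarrow> orthogonal z y"
      by (rule orthogonal_to_subspace_exists) blast
    have za: "z \<bullet> a = 0" and zV: "\<And>v. v \<in> V \<Longrightarrow> z \<bullet> v = 0"
      using z(2) by (auto simp: orthogonal_def intro: span_base)
    define r where "r = sqrt ((a \<bullet> a) * (2 * (a \<bullet> a) - 1)) / norm z"
    have r: "r\<^sup>2 * (z \<bullet> z) = (a \<bullet> a) * (2 * (a \<bullet> a) - 1)"
      using z(1) ge by (simp add: r_def power_divide power2_norm_eq_inner)
    have at: "a \<bullet> (a + r *\<^sub>R z) = a \<bullet> a"
      using za by (simp add: inner_add_right inner_commute)
    have "(a + r *\<^sub>R z) \<bullet> (a + r *\<^sub>R z) = a \<bullet> a + r\<^sup>2 * (z \<bullet> z)"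
      using za by (simp add: inner_add_left inner_add_right inner_commute power2_eq_square)
    also have "\<dots> = 2 * (a \<bullet> (a + r *\<^sub>R z))\<^sup>2"
      unfolding at r by (simp add: power2_eq_square algebra_simps)
    finally have "(a + r *\<^sub>R z) \<bullet> (a + r *\<^sub>R z) = 2 * (a \<bullet> (a + r *\<^sub>R z))\<^sup>2" .
    moreover have "a + r *\<^sub>R z \<noteq> 0"
      using at ge by (metis inner_zero_right mult_zero_right not_one_le_zero)
    moreover have "\<forall>v\<in>V. (a + r *\<^sub>R z) \<bullet> v = 0"
      using a zV by (simp add: inner_add_left)
    ultimately show ?thesis
      by blast
  qed
  then obtain t where t: "\<And>v. v \<in> V \<Longrightarrow> t \<bullet> v = 0" "t \<noteq> 0" "t \<bullet> t = 2 * (a \<bullet> t)\<^sup>2"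
    by blast
  let ?w = "reflect (axis j 1) t"
  have rr: "reflect (axis j 1) ?w = t"
    by (simp add: reflect_reflect inner_axis_axis)
  have "?w \<noteq> 0"
    using rr t(2) by (metis linear_0 linear_reflect)
  moreover have "axis j 1 \<bullet> t = a \<bullet> t"
    using t(1)[OF V] unfolding e by (simp add: inner_add_left inner_commute[of b t])
  then have "lorentz_inner ?w ?w = 0"
    using t(3) unfolding lorentz_inner_reflect_both[OF j]
    by (simp add: lorentz_inner_eq[OF j] power2_eq_square)
  moreover have "lorentz_inner v ?w = 0" if "v \<in> V" for v
    using t(1)[OF that] by (simp add: lorentz_inner_reflect_left[OF j] inner_commute)
  ultimately show ?thesis
    using that by blast
qed

section \<open>The classification\<close>

text \<open>
  The three parts decide every case: the whole space is time-like, so a subspace \<open>V\<close> that is not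
  time-like falls under the third part unless it is a space-like hyperplane.
\<close>

lemma A_equivalent_lorentz_dist_sq_map:
  fixes p :: "nat \<Rightarrow> real ^ 'a::{finite,wellorder}"
  assumes card: "CARD('b::{finite,wellorder}) = k + 1"
  defines "V \<equiv> recognition_subspace k p"
  shows "time_like_subspace V \<Longrightarrow>
      A_equivalent (lorentz_dist_sq_map p :: real ^ 'a::_ \<Rightarrow> real ^ 'b::_) (dist_sq_map p)"
    and "space_like_subspace V \<Longrightarrow> dim V + 1 = CARD('a) \<Longrightarrow>
      A_equivalent (lorentz_dist_sq_map p :: real ^ 'a::_ \<Rightarrow> real ^ 'b::_) (dist_sq_map p)"
    and "\<not> time_like_subspace V \<Longrightarrow> \<not> space_like_subspace V \<or> dim V + 2 \<le> CARD('a) \<Longrightarrow>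
      \<not> A_equivalent (lorentz_dist_sq_map p :: real ^ 'a::_ \<Rightarrow> real ^ 'b::_) (dist_sq_map p)"
proof -
  let ?E = "A_equivalent (lorentz_dist_sq_map p :: real ^ 'a::_ \<Rightarrow> real ^ 'b::_) (dist_sq_map p)"
  obtain j :: 'a where j: "coord_no j = 0"
    by (rule coord_no_obtain[of 0]) auto
  have subV: "subspace V"
    by (simp add: V_def recognition_subspace_def)
  then have spanV: "span V = V"
    by simp
  obtain a b where e: "axis j 1 = a + b" and bV: "b \<in> V" and a: "\<And>v. v \<in> V \<Longrightarrow> a \<bullet> v = 0"
    using orthogonal_subspace_decomp_exists[of V "axis j 1"] unfolding spanV orthogonal_def
    by (metis add.commute)
  note causal = subspace_causal_character[OF j e subV bV a]
  have "(axis j 1 :: real ^ 'a::_) \<bullet> axis j 1 = 1"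
    by (simp add: inner_axis_axis)
  then have sum1: "a \<bullet> a + b \<bullet> b = 1"
    using a[OF bV] by (simp add: e inner_add_left inner_add_right inner_commute)
  have Q: "lorentz_inner x x = x \<bullet> x - 2 * ((a + b) \<bullet> x)\<^sup>2" for x
    by (simp add: lorentz_inner_eq[OF j] e power2_eq_square)
  have bx: "b \<bullet> x = b \<bullet> v" if "\<And>u. u \<in> V \<Longrightarrow> u \<bullet> (x - v) = 0" for x v
    using that[OF bV] by (simp add: inner_diff_right)
  show ?E if "time_like_subspace V"
  proof -
    have less: "2 * (a \<bullet> a) < 1"
      using that causal by simp
    obtain B where B: "linear B" "inj B" "\<And>x. \<exists>r. B x = x + r *\<^sub>R a"
      "\<And>x. B x \<bullet> B x - 2 * ((a + b) \<bullet> B x)\<^sup>2 = x \<bullet> x - 2 / (1 - 2 * (a \<bullet> a)) * (b \<bullet> x)\<^sup>2"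
      using complete_square[OF a[OF bV] sum1] less by auto
    have perp: "v \<bullet> B x = v \<bullet> x" if "v \<in> V" for v x
      using B(3)[of x] a[OF that] by (auto simp: inner_add_right inner_commute)
    have "x \<bullet> x = 1 * lorentz_inner (B x) (B x) + 0 * (v \<bullet> v)
        + 2 / (1 - 2 * (a \<bullet> a)) * (b \<bullet> v)\<^sup>2"
      if nv: "\<And>u. u \<in> V \<Longrightarrow> u \<bullet> (x - v) = 0" for x v
      using bx[OF nv] by (simp add: Q B(4))
    then show ?thesis
      using B(1,2) perp
      by (intro A_equivalent_of_forms_agreeing[OF card, of B p 1 0 "2 / (1 - 2 * (a \<bullet> a))" b])
        (auto simp: V_def[symmetric])
  qed
  show ?E if sp: "space_like_subspace V" and dimV: "dim V + 1 = CARD('a)"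
  proof -
    have greater: "2 * (a \<bullet> a) > 1"
      using sp causal by simp
    then have pos: "a \<bullet> a > 0" by linarith
    obtain B where B: "linear B" "inj B" "\<And>x. \<exists>r. B x = x + r *\<^sub>R a"
      "\<And>x. B x \<bullet> B x - 2 * ((a + b) \<bullet> B x)\<^sup>2
        = x \<bullet> x - 2 / (a \<bullet> a) * (a \<bullet> x)\<^sup>2 - 2 / (1 - 2 * (a \<bullet> a)) * (b \<bullet> x)\<^sup>2"
      using complete_square[OF a[OF bV] sum1] greater by auto
    have perp: "v \<bullet> B x = v \<bullet> x" if "v \<in> V" for v x
      using B(3)[of x] a[OF that] by (auto simp: inner_add_right inner_commute)
    have "a \<notin> span V"
      using a[of a] pos by (auto simp: spanV)
    then have full: "span (insert a V) = UNIV"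
      using dimV by (simp add: dim_eq_full[symmetric] dim_insert)
    \<comment> \<open>As \<open>a\<close> spans the complement of \<open>V\<close>, the square of \<open>a \<bullet> x\<close> is a multiple of that of the normal
      part of \<open>x\<close>; this turns the reversed sign along \<open>a\<close> into \<open>- x \<bullet> x\<close>.\<close>
    have norm_split: "x \<bullet> x = v \<bullet> v + (a \<bullet> x)\<^sup>2 / (a \<bullet> a)"
      if v: "v \<in> V" and nv: "\<And>u. u \<in> V \<Longrightarrow> u \<bullet> (x - v) = 0" for x v
    proof -
      define z where "z = x - v - ((a \<bullet> x) / (a \<bullet> a)) *\<^sub>R a"
      have "orthogonal z y" if "y \<in> insert a V" for y
        using that a[of y] a[OF v] nv[of y] pos
        by (auto simp: orthogonal_def z_def inner_diff_left inner_commute inner_diff_right)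
      then have "orthogonal z z"
        using orthogonal_to_span[of z "insert a V" z] full by auto
      then have "x = v + ((a \<bullet> x) / (a \<bullet> a)) *\<^sub>R a"
        by (simp add: orthogonal_self z_def algebra_simps)
      then have "x \<bullet> x = (v + ((a \<bullet> x) / (a \<bullet> a)) *\<^sub>R a) \<bullet> (v + ((a \<bullet> x) / (a \<bullet> a)) *\<^sub>R a)"
        by simp
      also have "\<dots> = v \<bullet> v + (a \<bullet> x)\<^sup>2 / (a \<bullet> a)"
        using a[OF v] pos
        by (simp add: inner_add_left inner_add_right inner_commute power2_eq_square)
      finally show ?thesis .
    qed
    have form: "x \<bullet> x = - 1 * lorentz_inner (B x) (B x) + 2 * (v \<bullet> v)
        + (- 2 / (1 - 2 * (a \<bullet> a))) * (b \<bullet> v)\<^sup>2"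
      if v: "v \<in> V" and nv: "\<And>u. u \<in> V \<Longrightarrow> u \<bullet> (x - v) = 0" for x v
      using norm_split[OF v nv] bx[OF nv] by (simp add: Q B(4))
    show ?thesis
    proof (rule A_equivalent_of_forms_agreeing[OF card B(1,2)])
      show "v \<bullet> B x = v \<bullet> x" if "v \<in> recognition_subspace k p" for v x
        using perp that by (simp add: V_def)
      show "(- 1 :: real) \<noteq> 0"
        by simp
      show "x \<bullet> x = - 1 * lorentz_inner (B x) (B x) + 2 * (v \<bullet> v)
          + (- 2 / (1 - 2 * (a \<bullet> a))) * (b \<bullet> v)\<^sup>2"
        if "v \<in> recognition_subspace k p"
          and "\<And>u. u \<in> recognition_subspace k p \<Longrightarrow> u \<bullet> (x - v) = 0" for x v
        using form[of v x] that unfolding V_def by blast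
    qed
  qed
  show "\<not> ?E" if nt: "\<not> time_like_subspace V"
    and alt: "\<not> space_like_subspace V \<or> dim V + 2 \<le> CARD('a)"
  proof -
    have "2 * (a \<bullet> a) \<ge> 1" "2 * (a \<bullet> a) = 1 \<or> dim V + 2 \<le> CARD('a)"
      using nt alt causal by auto
    then obtain w where "w \<noteq> 0" "lorentz_inner w w = 0" "\<And>v. v \<in> V \<Longrightarrow> lorentz_inner v w = 0"
      using exists_null_normal_vector[OF j e bV a] by metis
    then show ?thesis
      by (intro not_A_equivalent_of_null_vector[OF card, of w]) (simp_all add: V_def)
  qed
qed

theorem corollary2:
  fixes n k :: nat
    and p :: "nat \<Rightarrow> real ^ 'a::{finite,wellorder}"
  assumes "n > 0" and "k > 0"
    and "CARD('a) = n + 1" and "CARD('b::{finite,wellorder}) = k + 1"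
  shows "(k < n \<and> general_position k p \<longrightarrow>
      (A_equivalent (lorentz_dist_sq_map p :: real ^ 'a::_ \<Rightarrow> real ^ 'b::_) (dist_sq_map p) \<longleftrightarrow>
        time_like_subspace (recognition_subspace k p)))
    \<and> (k = n \<and> general_position n p \<longrightarrow>
      (A_equivalent (lorentz_dist_sq_map p :: real ^ 'a::_ \<Rightarrow> real ^ 'b::_) (dist_sq_map p) \<longleftrightarrow>
        time_like_subspace (recognition_subspace n p) \<or>
        space_like_subspace (recognition_subspace n p)))
    \<and> (n < k \<and> general_position (n + 1) p \<longrightarrow>
      A_equivalent (lorentz_dist_sq_map p :: real ^ 'a::_ \<Rightarrow> real ^ 'b::_) (dist_sq_map p))"
proof -
  note eqv = A_equivalent_lorentz_dist_sq_map[OF assms(4), of p]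
  have "time_like_subspace (recognition_subspace k p)" if "n < k" "general_position (n + 1) p"
  proof -
    have "span (recognition_subspace (n + 1) p) = UNIV"
      using that(2) assms(3) by (simp add: general_position_def dim_eq_full[symmetric])
    moreover have "recognition_subspace (n + 1) p \<subseteq> recognition_subspace k p"
      unfolding recognition_subspace_def using that(1) by (intro span_mono image_mono) auto
    ultimately have full: "recognition_subspace k p = UNIV"
      unfolding recognition_subspace_def span_span by blast
    obtain j :: 'a where j: "coord_no j = 0"
      by (rule coord_no_obtain[of 0]) auto
    show ?thesis
      unfolding full by (subst subspace_causal_character(1)[OF j, of 0 "axis j 1"]) auto
  qed
  then show ?thesis
    using eqv assms(3) unfolding general_position_def by force
qed

end
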